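(* Let $n, m \in \mathbb{N}$ with $m > 1$ and $n > 1$, let $i \in \{1,\dots,n\}$, and let $A \subset \mathbb{R}^m$. Then the following conditions are equivalent. (i) The set $A$ is compact. (ii) There exists a continuous function $g \colon I^n \to \mathbb{R}^m$ such that $\mathsf{Conn}_i(g) = A$. (iii) There exists a continuous function $g \colon I^n \to \mathbb{R}^m$ such that $\mathsf{Sep}_i(g) = A$.
   Context: $I^n = [0,1]^n$; for $i \in \{1,\dots,n\}$, $I^n_{i,-} = \{z \in I^n : z_i = 0\}$ and $I^n_{i,+} = \{z \in I^n : z_i = 1\}$. A subset $B \subset I^n$ connects $i$th opposite faces of $I^n$ if there is a connected subset $S \subset B$ with $S \cap I^n_{i,-} \ne \emptyset \ne S \cap I^n_{i,+}$; $B$ separates $i$th opposite faces of $I^n$ if $I^n \setminus B$ does not connect $i$th opposite faces of $I^n$. For a continuous $g \colon I^n \to \mathbb{R}^m$, $\mathsf{Conn}_i(g)$ (resp. $\mathsf{Sep}_i(g)$) is the set of all $p \in \mathbb{R}^m$ such that $g^{-1}[\{p\}]$ connects (resp. separates) $i$th opposite faces of $I^n$. *)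

theory Defs
  imports "HOL-Analysis.Analysis"
begin

definition unit_cube :: "(real ^ 'n) set" where
  "unit_cube = {z. \<forall>j. 0 \<le> z $ j \<and> z $ j \<le> 1}"

definition face_minus :: "'n \<Rightarrow> (real ^ 'n) set" where
  "face_minus i = {z \<in> unit_cube. z $ i = 0}"

definition face_plus :: "'n \<Rightarrow> (real ^ 'n) set" where
  "face_plus i = {z \<in> unit_cube. z $ i = 1}"

definition connects_faces :: "'n::finite \<Rightarrow> (real ^ 'n) set \<Rightarrow> bool" where
  "connects_faces i B \<longleftrightarrow>
    (\<exists>S. S \<subseteq> B \<and> connected S \<and> S \<inter> face_minus i \<noteq> {} \<and> S \<inter> face_plus i \<noteq> {})"

definition separates_faces :: "'n::finite \<Rightarrow> (real ^ 'n) set \<Rightarrow> bool" where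
  "separates_faces i B \<longleftrightarrow> \<not> connects_faces i (unit_cube - B)"

text \<open>
  The functions below are total on \<^typ>\<open>real ^ 'n\<close> but stand for maps defined on the cube,
  so fibres are intersected with the cube.
\<close>

definition cube_fibre :: "(real ^ 'n \<Rightarrow> real ^ 'm) \<Rightarrow> real ^ 'm \<Rightarrow> (real ^ 'n) set" where
  "cube_fibre g p = {z \<in> unit_cube. g z = p}"

definition Conn :: "'n::finite \<Rightarrow> (real ^ 'n \<Rightarrow> real ^ 'm) \<Rightarrow> (real ^ 'm) set" where
  "Conn i g = {p. connects_faces i (cube_fibre g p)}"

definition Sep :: "'n::finite \<Rightarrow> (real ^ 'n \<Rightarrow> real ^ 'm) \<Rightarrow> (real ^ 'm) set" where
  "Sep i g = {p. separates_faces i (cube_fibre g p)}"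

end

theory Submission
  imports Defs
begin

text \<open>
  Compactness of \<open>Sep i g\<close> follows since a connection in the complement of a fibre can be taken
  to be a path, which also avoids all nearby fibres.  For \<open>Conn i g\<close>, a compact fibre that fails
  to connect the faces splits into two closed pieces (cut-wire theorem), and the nearby fibres lie
  in disjoint neighbourhoods of these pieces.

  Conversely, let \<open>A\<close> be compact, \<open>\<gamma>\<close> a space-filling curve whose image contains \<open>A\<close>, \<open>C\<close> the set of
  parameters with \<open>\<gamma> s \<in> A\<close>, \<open>h s\<close> the distance from \<open>s\<close> to \<open>C\<close>, and put
  \<open>G s u = \<gamma> s + h s * (u * e\<^sub>1 + \<epsilon> * e\<^sub>2)\<close>.  For \<open>s \<in> C\<close> the map \<open>G s\<close> is constant, so the
  fibres over \<open>A\<close> contain a full line.  Off \<open>C\<close>, \<open>s\<close> and \<open>G s u\<close> determine \<open>u\<close>, and for all but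
  countably many \<open>\<epsilon>\<close> the second coordinate \<open>\<gamma>\<^sub>2 + \<epsilon> * h\<close> is constant on no interval disjoint from
  \<open>C\<close>; so a fibre over a point outside \<open>A\<close> is a graph over a set of parameters without interior.
  Such a fibre has no nondegenerate connected subset, and its complement in the square connects
  opposite sides.  Taking \<open>s\<close> transversal, respectively parallel, to the direction \<open>i\<close> gives
  \<open>Conn i g = A\<close>, respectively \<open>Sep i g = A\<close>.
\<close>

subsection \<open>Compactness of the sets of connecting and separating values\<close>

lemma unit_cube_eq_cbox: "unit_cube = cbox 0 (1 :: real ^ 'n::finite)"
  by (rule set_eqI) (simp add: unit_cube_def mem_box_cart)

lemma compact_unit_cube: "compact (unit_cube :: (real ^ 'n::finite) set)"
  by (simp add: unit_cube_eq_cbox)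

lemma compact_face_minus: "compact (face_minus i :: (real ^ 'n::finite) set)"
proof -
  have "face_minus i = unit_cube \<inter> {z. z $ i = 0}" by (auto simp: face_minus_def)
  moreover have "closed {z :: real ^ 'n. z $ i = 0}"
    by (intro closed_Collect_eq continuous_intros)
  ultimately show ?thesis using compact_Int_closed[OF compact_unit_cube] by simp
qed

lemma compact_face_plus: "compact (face_plus i :: (real ^ 'n::finite) set)"
proof -
  have "face_plus i = unit_cube \<inter> {z. z $ i = 1}" by (auto simp: face_plus_def)
  moreover have "closed {z :: real ^ 'n. z $ i = 1}"
    by (intro closed_Collect_eq continuous_intros)
  ultimately show ?thesis using compact_Int_closed[OF compact_unit_cube] by simp
qed

lemma closed_cube_fibre:
  fixes g :: "real ^ 'n::finite \<Rightarrow> real ^ 'm::finite"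
  assumes "continuous_on unit_cube g"
  shows "closed (cube_fibre g p)"
proof -
  have "cube_fibre g p = unit_cube \<inter> g -` {p}" by (auto simp: cube_fibre_def)
  then show ?thesis
    using continuous_closed_preimage[OF assms compact_imp_closed[OF compact_unit_cube] closed_singleton]
    by simp
qed

lemma compact_Conn:
  fixes g :: "real ^ 'n::finite \<Rightarrow> real ^ 'm::finite"
  assumes g: "continuous_on unit_cube g"
  shows "compact (Conn i g)"
proof -
  have "Conn i g \<subseteq> g ` unit_cube"
    unfolding Conn_def connects_faces_def cube_fibre_def by blast
  then have "bounded (Conn i g)"
    using compact_continuous_image[OF g compact_unit_cube] compact_imp_bounded bounded_subset by blast
  moreover have "open (- Conn i g)"
  proof (subst open_subopen, rule ballI)
    fix p assume p: "p \<in> - Conn i g"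
    define F where "F = cube_fibre g p"
    have Fsub: "F \<subseteq> unit_cube" unfolding F_def cube_fibre_def by auto
    have F: "closed F" unfolding F_def by (rule closed_cube_fibre[OF g])
    then have Fc: "compact F"
      using Fsub compact_unit_cube compact_Int_closed[of unit_cube F] by (simp add: Int_absorb1)
    \<comment> \<open>In a compact Hausdorff space, two closed sets that no connected set meets
      jointly can be separated by a clopen partition; this turns the failure to connect into the
      pieces \<open>K\<close> and \<open>L\<close>.\<close>
    have "separated_between (top_of_set F) (F \<inter> face_minus i) (F \<inter> face_plus i)"
    proof (rule cut_wire_fence_theorem)
      show "compact_space (top_of_set F)" using Fc by (simp add: compact_space_subtopology)
      show "Hausdorff_space (top_of_set F)" by (simp add: Hausdorff_space_subtopology)
      show "closedin (top_of_set F) (F \<inter> face_minus i)"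
        by (rule closedin_closed_Int[OF compact_imp_closed[OF compact_face_minus]])
      show "closedin (top_of_set F) (F \<inter> face_plus i)"
        by (rule closedin_closed_Int[OF compact_imp_closed[OF compact_face_plus]])
      show "disjnt S (F \<inter> face_minus i) \<or> disjnt S (F \<inter> face_plus i)"
        if "connectedin (top_of_set F) S" for S
      proof -
        have "connected S" "S \<subseteq> F" using that by (auto simp: connectedin_subtopology)
        moreover have "\<not> connects_faces i F" using p by (simp add: Conn_def F_def)
        ultimately have "S \<inter> face_minus i = {} \<or> S \<inter> face_plus i = {}"
          unfolding connects_faces_def by metis
        then show ?thesis by (auto simp: disjnt_def)
      qed
    qed
    then obtain K L where KL: "openin (top_of_set F) K" "openin (top_of_set F) L" "K \<union> L = F"
      "K \<inter> L = {}" "F \<inter> face_minus i \<subseteq> K" "F \<inter> face_plus i \<subseteq> L"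
      unfolding separated_between_def disjnt_def by auto
    have "F - K = L" "F - L = K" "K \<subseteq> F" "L \<subseteq> F" using KL(3,4) by auto
    then have "closedin (top_of_set F) K" "closedin (top_of_set F) L"
      using KL(1,2) by (simp_all add: closedin_def)
    then have "closed K" "closed L"
      using F closedin_closed_trans by blast+
    then obtain U V where UV: "open U" "open V" "K \<subseteq> U" "L \<subseteq> V" "U \<inter> V = {}"
      using separation_normal[OF _ _ KL(4)] by blast
    define W where "W = (unit_cube - (U \<union> V)) \<union> (face_minus i - U) \<union> (face_plus i - V)"
    have "compact W" unfolding W_def
      using UV compact_unit_cube compact_face_minus compact_face_plus
      by (intro compact_Un compact_diff open_Un) auto
    moreover have Wsub: "W \<subseteq> unit_cube" unfolding W_def face_minus_def face_plus_def by auto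
    ultimately have "closed (g ` W)"
      using compact_continuous_image continuous_on_subset[OF g] compact_imp_closed by blast
    moreover have "p \<notin> g ` W"
    proof
      assume "p \<in> g ` W"
      then obtain w where "w \<in> W" "w \<in> F" using Wsub unfolding F_def cube_fibre_def by auto
      then show False using KL UV unfolding W_def by blast
    qed
    moreover have "- (g ` W) \<subseteq> - Conn i g"
    proof (intro subsetI ComplI)
      fix q assume q: "q \<in> - (g ` W)" "q \<in> Conn i g"
      then obtain S where S: "S \<subseteq> cube_fibre g q" "connected S"
        "S \<inter> face_minus i \<noteq> {}" "S \<inter> face_plus i \<noteq> {}"
        unfolding Conn_def connects_faces_def by blast
      have "S \<inter> W = {}" using q(1) S(1) unfolding cube_fibre_def by blast
      moreover have "S \<subseteq> unit_cube" using S(1) unfolding cube_fibre_def by blast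
      ultimately have "S \<subseteq> U \<union> V" "U \<inter> S \<noteq> {}" "V \<inter> S \<noteq> {}"
        using S(3,4) unfolding W_def by blast+
      then show False using connectedD[OF S(2) UV(1,2)] UV(5) by blast
    qed
    ultimately show "\<exists>T. open T \<and> p \<in> T \<and> T \<subseteq> - Conn i g"
      using open_Compl by blast
  qed
  ultimately show ?thesis by (simp add: compact_eq_bounded_closed closed_def)
qed

lemma compact_Sep:
  fixes g :: "real ^ 'n::finite \<Rightarrow> real ^ 'm::finite"
  assumes g: "continuous_on unit_cube g"
  shows "compact (Sep i g)"
proof -
  have "Sep i g \<subseteq> g ` unit_cube"
  proof
    \<comment> \<open>A value that is not attained has an empty fibre, and the whole cube joins the
      two faces.\<close>
    fix p assume p: "p \<in> Sep i g"
    show "p \<in> g ` unit_cube"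
    proof (rule ccontr)
      assume "p \<notin> g ` unit_cube"
      then have "cube_fibre g p = {}" unfolding cube_fibre_def by blast
      moreover have "connected (unit_cube :: (real ^ 'n) set)"
        by (simp add: unit_cube_eq_cbox convex_connected)
      moreover have "0 \<in> (unit_cube :: (real ^ 'n) set) \<inter> face_minus i"
        by (auto simp: face_minus_def unit_cube_def)
      moreover have "1 \<in> (unit_cube :: (real ^ 'n) set) \<inter> face_plus i"
        by (auto simp: face_plus_def unit_cube_def)
      ultimately have "connects_faces i (unit_cube - cube_fibre g p)"
        unfolding connects_faces_def by blast
      then show False using p unfolding Sep_def separates_faces_def by blast
    qed
  qed
  then have "bounded (Sep i g)"
    using compact_continuous_image[OF g compact_unit_cube] compact_imp_bounded bounded_subset by blast
  moreover have "open (- Sep i g)"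
  proof (subst open_subopen, rule ballI)
    fix p assume "p \<in> - Sep i g"
    then obtain S x y where S: "S \<subseteq> unit_cube - cube_fibre g p" "connected S"
      "x \<in> S" "x \<in> face_minus i" "y \<in> S" "y \<in> face_plus i"
      unfolding Sep_def separates_faces_def connects_faces_def by blast
    \<comment> \<open>The complement of the fibre is open in a locally path connected cube, so its
      components are path components. A path, unlike an arbitrary connecting set, has compact image,
      which keeps its values at positive distance from p.\<close>
    have "openin (top_of_set unit_cube) (unit_cube - cube_fibre g p)"
      using closed_cube_fibre[OF g]
      by (intro openin_diff openin_subtopology_self closed_subset) (auto simp: cube_fibre_def)
    moreover have "locally path_connected (unit_cube :: (real ^ 'n) set)"
      by (simp add: unit_cube_eq_cbox convex_imp_locally_path_connected)
    ultimately have "locally path_connected (unit_cube - cube_fibre g p)"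
      by (rule locally_open_subset[rotated])
    moreover have "connected_component (unit_cube - cube_fibre g p) x y"
      using S unfolding connected_component_def by blast
    ultimately have "path_component (unit_cube - cube_fibre g p) x y"
      by (simp add: path_component_eq_connected_component)
    then obtain \<pi> where \<pi>: "path \<pi>" "path_image \<pi> \<subseteq> unit_cube - cube_fibre g p"
      "pathstart \<pi> = x" "pathfinish \<pi> = y"
      unfolding path_component_def by blast
    let ?P = "path_image \<pi>"
    have "compact (g ` ?P)"
      using \<pi>(2) by (intro compact_continuous_image compact_path_image \<pi>(1))
        (auto intro: continuous_on_subset[OF g])
    then have "open (- (g ` ?P))" using compact_imp_closed by blast
    moreover have "p \<in> - (g ` ?P)" using \<pi>(2) unfolding cube_fibre_def by blast
    moreover have "- (g ` ?P) \<subseteq> - Sep i g"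
    proof (rule subsetI)
      fix q assume "q \<in> - (g ` ?P)"
      then have "?P \<subseteq> unit_cube - cube_fibre g q" using \<pi>(2) unfolding cube_fibre_def by blast
      moreover have "x \<in> ?P" "y \<in> ?P"
        using \<pi>(3,4) pathstart_in_path_image pathfinish_in_path_image by blast+
      ultimately show "q \<in> - Sep i g"
        using connected_path_image[OF \<pi>(1)] S(4,6)
        unfolding Sep_def separates_faces_def connects_faces_def by blast
    qed
    ultimately show "\<exists>T. open T \<and> p \<in> T \<and> T \<subseteq> - Sep i g" by blast
  qed
  ultimately show ?thesis by (simp add: compact_eq_bounded_closed closed_def)
qed

subsection \<open>A space-filling curve\<close>

text \<open>The partial sums of the digit series are the truncations
  \<open>\<lfloor>2 ^ n * x\<rfloor> / 2 ^ n\<close>, which lie within \<open>(1/2) ^ n\<close> of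
  x. The bounds on x make its integer part 0, matching the empty sum.\<close>

lemma binary_expansion:
  fixes x :: real
  assumes "0 \<le> x" "x < 1"
  obtains d :: "nat \<Rightarrow> real" where "\<And>k. d k \<in> {0, 1}" "(\<lambda>k. d k / 2 ^ Suc k) sums x"
proof
  define d where "d k = real_of_int (\<lfloor>2 ^ Suc k * x\<rfloor> mod 2)" for k
  show "d k \<in> {0, 1}" for k
    using pos_mod_bound[of 2 "\<lfloor>2 ^ Suc k * x\<rfloor>"] pos_mod_sign[of 2 "\<lfloor>2 ^ Suc k * x\<rfloor>"]
    unfolding d_def by auto
  have half: "\<lfloor>2 * y\<rfloor> = 2 * \<lfloor>y\<rfloor> + \<lfloor>2 * y\<rfloor> mod 2" for y :: real
  proof -
    have "\<lfloor>2 * y\<rfloor> = 2 * \<lfloor>y\<rfloor> \<or> \<lfloor>2 * y\<rfloor> = 2 * \<lfloor>y\<rfloor> + 1"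
      by linarith
    then show ?thesis by auto
  qed
  have partial: "(\<Sum>k<n. d k / 2 ^ Suc k) = of_int \<lfloor>2 ^ n * x\<rfloor> / 2 ^ n" for n
  proof (induction n)
    case 0
    have "\<lfloor>x\<rfloor> = 0" using assms by linarith
    then show ?case by simp
  next
    case (Suc n)
    have "real_of_int \<lfloor>2 ^ Suc n * x\<rfloor> = 2 * of_int \<lfloor>2 ^ n * x\<rfloor> + d n"
      using half[of "2 ^ n * x"] unfolding d_def
      by (metis (no_types, opaque_lifting) mult.assoc of_int_add of_int_mult of_int_numeral power_Suc)
    then show ?case using Suc by (simp add: field_simps)
  qed
  have "(\<lambda>n. of_int \<lfloor>2 ^ n * x\<rfloor> / 2 ^ n) \<longlonglongrightarrow> x"
  proof (rule tendsto_sandwich)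
    show "\<forall>\<^sub>F n in sequentially. x - (1/2) ^ n \<le> of_int \<lfloor>2 ^ n * x\<rfloor> / 2 ^ n"
    proof (rule always_eventually, rule allI)
      fix n
      have "2 ^ n * x - 1 \<le> of_int \<lfloor>2 ^ n * x\<rfloor>" by linarith
      then have "(2 ^ n * x - 1) / 2 ^ n \<le> of_int \<lfloor>2 ^ n * x\<rfloor> / 2 ^ n"
        by (rule divide_right_mono) simp
      then show "x - (1/2) ^ n \<le> of_int \<lfloor>2 ^ n * x\<rfloor> / 2 ^ n"
        by (simp add: diff_divide_distrib power_one_over)
    qed
    show "\<forall>\<^sub>F n in sequentially. of_int \<lfloor>2 ^ n * x\<rfloor> / 2 ^ n \<le> x"
    proof (rule always_eventually, rule allI)
      fix n
      have "of_int \<lfloor>2 ^ n * x\<rfloor> \<le> 2 ^ n * x" by linarith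
      then show "of_int \<lfloor>2 ^ n * x\<rfloor> / 2 ^ n \<le> x"
        by (simp add: field_simps)
    qed
    have "(\<lambda>n. (1/2::real) ^ n) \<longlonglongrightarrow> 0" by (rule LIMSEQ_power_zero) simp
    then show "(\<lambda>n. x - (1/2) ^ n) \<longlonglongrightarrow> x"
      using tendsto_diff[OF tendsto_const[of x]] by fastforce
  qed simp
  then show "(\<lambda>k. d k / 2 ^ Suc k) sums x"
    unfolding sums_def partial .
qed

section \<open>Reading digits off Cantor points\<close>

text \<open>
  A point of the Cantor set with ternary digits \<open>2 * d k\<close> satisfies
  \<open>3 ^ k * t = 2 * N + r\<close> with \<open>N\<close> an integer and \<open>r\<close> in the first or last third of the unit
  interval, according to \<open>d k\<close>.  This is Schoenberg's device; the 2-periodic function below reads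
  off the digit.
\<close>

definition digit_fun :: "nat \<Rightarrow> real \<Rightarrow> real" where
  "digit_fun k t = max 0 (min 1 (1/2 - cos (pi * (3 ^ k * t))))"

lemma continuous_on_digit_fun: "continuous_on S (digit_fun k)"
  unfolding digit_fun_def[abs_def] by (intro continuous_intros)

lemma digit_fun_bounds: "0 \<le> digit_fun k t" "digit_fun k t \<le> 1"
  by (auto simp: digit_fun_def)

text \<open>A single Cantor point serves all k: multiplying by 3 shifts the ternary digits, so
  modulo 2 the number \<open>3 ^ k * t\<close> is the Cantor point of the shifted sequence, whose
  leading digit is \<open>2 * d k\<close>.\<close>

lemma digit_fun_prescribed:
  fixes d :: "nat \<Rightarrow> real"
  assumes d: "\<And>k. d k \<in> {0, 1}"
  obtains t where "0 \<le> t" "t \<le> 1" "\<And>k. digit_fun k t = d k"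
proof
  define T where "T e = (\<Sum>k. 2 * e k / 3 ^ Suc k)" for e :: "nat \<Rightarrow> real"
  have geo: "(\<lambda>k. 2 / 3 ^ Suc k :: real) sums 1"
    using sums_mult[OF geometric_sums[of "1/3 :: real"], of "2/3"]
    by (simp add: power_divide)
  have summ: "summable (\<lambda>k. 2 * e k / 3 ^ Suc k)" if "\<And>k. e k \<in> {0, 1}" for e :: "nat \<Rightarrow> real"
  proof (rule summable_comparison_test'[OF sums_summable[OF geo], of 0])
    show "norm (2 * e n / 3 ^ Suc n) \<le> 2 / 3 ^ Suc n" for n
      using that[of n] by auto
  qed
  have T01: "0 \<le> T e" "T e \<le> 1" if e: "\<And>k. e k \<in> {0, 1}" for e
  proof -
    have "0 \<le> 2 * e n / 3 ^ Suc n" "2 * e n / 3 ^ Suc n \<le> 2 / 3 ^ Suc n" for n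
      using e[of n] by auto
    then show "0 \<le> T e" "T e \<le> 1"
      using suminf_nonneg[OF summ[OF e]] suminf_le[OF _ summ[OF e] sums_summable[OF geo]]
        sums_unique[OF geo] unfolding T_def by simp_all
  qed
  have step: "3 * T e = 2 * e 0 + T (\<lambda>k. e (Suc k))" if e: "\<And>k. e k \<in> {0, 1}" for e
  proof -
    have "T e = (\<Sum>k. 2 * e (Suc k) / 3 ^ Suc (Suc k)) + 2 * e 0 / 3"
      using suminf_split_head[OF summ[of e]] e unfolding T_def by simp
    also have "(\<Sum>k. 2 * e (Suc k) / 3 ^ Suc (Suc k)) = (\<Sum>k. (2 * e (Suc k) / 3 ^ Suc k) / 3)"
      by (simp add: field_simps)
    also have "\<dots> = T (\<lambda>k. e (Suc k)) / 3"
      unfolding T_def using suminf_divide[OF summ[of "\<lambda>k. e (Suc k)"]] e by blast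
    finally show ?thesis by simp
  qed
  have shift: "\<exists>N::int. 3 ^ k * T d = 2 * of_int N + T (\<lambda>i. d (i + k))" for k
  proof (induction k)
    case 0
    then show ?case by (auto intro: exI[of _ 0])
  next
    case (Suc k)
    then obtain N :: int where N: "3 ^ k * T d = 2 * of_int N + T (\<lambda>i. d (i + k))" by blast
    have "3 * T (\<lambda>i. d (i + k)) = 2 * d k + T (\<lambda>i. d (i + Suc k))"
      using step[of "\<lambda>i. d (i + k)"] d by simp
    moreover obtain b :: int where "d k = of_int b"
      using d[of k] by (metis insertE of_int_0 of_int_1 singletonD)
    ultimately have "3 ^ Suc k * T d = 2 * of_int (3 * N + b) + T (\<lambda>i. d (i + Suc k))"
      using N by simp
    then show ?case by blast
  qed
  show "0 \<le> T d" "T d \<le> 1" using T01 d by auto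
  show "digit_fun k (T d) = d k" for k
  proof -
    obtain N :: int where N: "3 ^ k * T d = 2 * of_int N + T (\<lambda>i. d (i + k))"
      using shift by blast
    define x where "x = T (\<lambda>i. d (i + k))"
    have cosx: "cos (pi * (3 ^ k * T d)) = cos (pi * x)"
    proof -
      have "pi * (3 ^ k * T d) = pi * x + 2 * pi * of_int N"
        unfolding N x_def by (simp add: algebra_simps)
      then show ?thesis
        by (simp only: cos_add cos_int_2pin sin_int_2pin)
    qed
    define y where "y = T (\<lambda>i. d (Suc i + k))"
    have y: "0 \<le> y" "y \<le> 1" unfolding y_def using T01[of "\<lambda>i. d (Suc i + k)"] d by auto
    have x: "3 * x = 2 * d k + y"
      unfolding x_def y_def using step[of "\<lambda>i. d (i + k)"] d by simp
    \<comment> \<open>On the first third \<open>cos (pi * x)\<close> is at least 1/2 and on the last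
      third at most -1/2, so the clamp in \<open>digit_fun\<close> returns exactly 0 or 1.\<close>
    consider "d k = 0" | "d k = 1" using d[of k] by auto
    then show ?thesis
    proof cases
      case 1
      then have "0 \<le> x" "x \<le> 1/3" using x y by auto
      then have "cos (pi / 3) \<le> cos (pi * x)"
        by (intro cos_monotone_0_pi_le) (auto simp: field_simps)
      then show ?thesis unfolding digit_fun_def cosx 1 by (simp add: cos_60)
    next
      case 2
      then have "2/3 \<le> x" "x \<le> 1" using x y by auto
      then have "cos (pi * x) \<le> cos (pi * (2/3))"
        by (intro cos_monotone_0_pi_le) (auto simp: field_simps)
      moreover have "cos (pi * (2/3)) = - 1/2"
        using cos_120 by (simp add: mult.commute)
      ultimately show ?thesis unfolding digit_fun_def cosx 2 by simp
    qed
  qed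
qed

text \<open>Schoenberg's curve: the digit indices are partitioned among the coordinates by a pairing
  function, so one parameter prescribes the binary digits of all coordinates independently.
  Continuity is uniform convergence by the M-test.\<close>

lemma space_filling_curve_unit_interval:
  obtains \<gamma> :: "real \<Rightarrow> real ^ 'm::finite"
  where "continuous_on UNIV \<gamma>"
    "\<And>x. (\<And>c. 0 \<le> x $ c \<and> x $ c < 1) \<Longrightarrow> \<exists>t\<in>{0..1}. \<gamma> t = x"
proof -
  obtain e :: "'m \<Rightarrow> nat" where e: "inj e"
    using finite_imp_inj_to_nat_seg[OF finite_class.finite_UNIV] by metis
  define q where "q k c = prod_encode (k, e c)" for k c
  define \<gamma> :: "real \<Rightarrow> real ^ 'm"
    where "\<gamma> t = (\<chi> c. \<Sum>k. digit_fun (q k c) t / 2 ^ Suc k)" for t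
  have geo: "summable (\<lambda>k. 1 / 2 ^ Suc k :: real)"
    using sums_summable[OF power_half_series] by (simp add: power_divide)
  have "continuous_on UNIV (\<lambda>t. \<Sum>k. digit_fun (q k c) t / 2 ^ Suc k)" for c
  proof (rule uniform_limit_theorem)
    show "uniform_limit UNIV (\<lambda>n t. \<Sum>k<n. digit_fun (q k c) t / 2 ^ Suc k)
      (\<lambda>t. \<Sum>k. digit_fun (q k c) t / 2 ^ Suc k) sequentially"
      by (rule Weierstrass_m_test[OF _ geo])
        (simp add: digit_fun_bounds divide_right_mono abs_of_nonneg)
    show "\<forall>\<^sub>F n in sequentially. continuous_on UNIV (\<lambda>t. \<Sum>k<n. digit_fun (q k c) t / 2 ^ Suc k)"
      by (intro always_eventually allI continuous_intros continuous_on_digit_fun) auto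
  qed simp
  then have cont: "continuous_on UNIV \<gamma>"
    unfolding \<gamma>_def[abs_def] by (rule continuous_on_vec_lambda)
  have "\<exists>t\<in>{0..1}. \<gamma> t = x" if x: "\<And>c. 0 \<le> x $ c \<and> x $ c < 1" for x
  proof -
    have "\<exists>d :: nat \<Rightarrow> real. (\<forall>k. d k \<in> {0, 1}) \<and> (\<lambda>k. d k / 2 ^ Suc k) sums (x $ c)" for c
      using x[of c] by (metis binary_expansion)
    then obtain d :: "'m \<Rightarrow> nat \<Rightarrow> real" where d: "\<And>c k. d c k \<in> {0, 1}"
        "\<And>c. (\<lambda>k. d c k / 2 ^ Suc k) sums (x $ c)"
      by metis
    \<comment> \<open>Interleaves the digit sequences. An index whose second part is not in the
      range of \<open>e\<close> receives a digit of an arbitrary coordinate, still 0 or 1.\<close>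
    define D where "D n = (case prod_decode n of (k, l) \<Rightarrow> d (inv e l) k)" for n
    have "D n \<in> {0, 1}" for n unfolding D_def using d(1) by (auto split: prod.split)
    then obtain t where t: "0 \<le> t" "t \<le> 1" "\<And>k. digit_fun k t = D k"
      using digit_fun_prescribed by blast
    have "D (q k c) = d c k" for k c
      unfolding D_def q_def by (simp add: e)
    then have "\<gamma> t = x"
      unfolding \<gamma>_def t(3) using sums_unique[OF d(2)] by (simp add: vec_eq_iff)
    then show ?thesis using t by auto
  qed
  then show ?thesis using that cont by blast
qed

text \<open>Shifting the unit cube by its centre and scaling by \<open>2 * R\<close> covers every
  point whose coordinates are below R in absolute value.\<close>

lemma space_filling_curve:
  fixes A :: "(real ^ 'm::finite) set"
  assumes "bounded A"
  obtains \<gamma> :: "real \<Rightarrow> real ^ 'm" where "continuous_on UNIV \<gamma>" "A \<subseteq> \<gamma> ` {0..1}"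
proof -
  obtain \<beta> :: "real \<Rightarrow> real ^ 'm" where \<beta>: "continuous_on UNIV \<beta>"
    "\<And>x. (\<And>c. 0 \<le> x $ c \<and> x $ c < 1) \<Longrightarrow> \<exists>t\<in>{0..1}. \<beta> t = x"
    using space_filling_curve_unit_interval by blast
  obtain R where R: "R > 0" "\<And>x. x \<in> A \<Longrightarrow> norm x < R"
    using bounded_pos_less[of A] assms by auto
  define b :: "real ^ 'm" where "b = (\<chi> c. 1/2)"
  define \<gamma> where "\<gamma> t = (2 * R) *\<^sub>R (\<beta> t - b)" for t
  have "continuous_on UNIV \<gamma>" unfolding \<gamma>_def by (intro continuous_intros \<beta>)
  moreover have "x \<in> \<gamma> ` {0..1}" if "x \<in> A" for x
  proof -
    have "0 \<le> (x /\<^sub>R (2 * R) + b) $ c \<and> (x /\<^sub>R (2 * R) + b) $ c < 1" for c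
    proof -
      have "\<bar>x $ c\<bar> < R" using R(2)[OF that] component_le_norm_cart[of x c] by linarith
      then show ?thesis using R(1) unfolding b_def by (auto simp: field_simps)
    qed
    then obtain t where "t \<in> {0..1}" "\<beta> t = x /\<^sub>R (2 * R) + b" using \<beta>(2) by blast
    then show ?thesis using R(1) unfolding \<gamma>_def by (intro image_eqI[of _ _ t]) auto
  qed
  ultimately show ?thesis using that by blast
qed

subsection \<open>Realising a compact set\<close>

text \<open>If two values of \<epsilon> made the perturbed function constant on the same interval,
  subtraction would make h constant there. So each rational interval rules out at most one
  \<epsilon>, hence countably many in all.\<close>

lemma generic_perturbation_nonconstant:
  fixes f h :: "real \<Rightarrow> real"
  assumes h: "\<And>a b. a < b \<Longrightarrow> {a..b} \<inter> C = {} \<Longrightarrow> \<not> h constant_on {a..b}"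
  obtains \<epsilon> :: real
  where "\<And>a b. a < b \<Longrightarrow> {a..b} \<inter> C = {} \<Longrightarrow> \<not> (\<lambda>s. f s + \<epsilon> * h s) constant_on {a..b}"
proof -
  define E where "E a b = {\<epsilon>. (\<lambda>s. f s + \<epsilon> * h s) constant_on {a..b}}" for a b :: real
  define I where "I = {(a, b). a \<in> \<rat> \<and> b \<in> \<rat> \<and> a < b \<and> {a..b} \<inter> C = {}}"
  have single: "\<epsilon> = \<delta>" if "\<epsilon> \<in> E a b" "\<delta> \<in> E a b" "(a, b) \<in> I" for \<epsilon> \<delta> a b
  proof (rule ccontr)
    assume ne: "\<epsilon> \<noteq> \<delta>"
    from that(1,2) obtain y z where yz:
      "\<forall>s\<in>{a..b}. f s + \<epsilon> * h s = y" "\<forall>s\<in>{a..b}. f s + \<delta> * h s = z"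
      unfolding E_def constant_on_def mem_Collect_eq by (elim exE)
    have "(\<epsilon> - \<delta>) * h s = y - z" if "s \<in> {a..b}" for s
      using bspec[OF yz(1) that] bspec[OF yz(2) that] by (simp add: left_diff_distrib)
    then have "h s = (y - z) / (\<epsilon> - \<delta>)" if "s \<in> {a..b}" for s
      using ne that by (simp add: eq_divide_eq mult.commute)
    then have "h constant_on {a..b}" unfolding constant_on_def by blast
    then show False using h that(3) unfolding I_def by auto
  qed
  have "countable (\<Union>(a, b)\<in>I. E a b)"
  proof (rule countable_UN)
    have "I \<subseteq> \<rat> \<times> \<rat>" unfolding I_def by auto
    then show "countable I"
      by (rule countable_subset) (intro countable_SIGMA countable_rat)
    show "countable (case p of (a, b) \<Rightarrow> E a b)" if "p \<in> I" for p
    proof -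
      obtain a b where p: "p = (a, b)" by fastforce
      have "E a b \<subseteq> {SOME \<epsilon>. \<epsilon> \<in> E a b}"
      proof
        fix \<epsilon> assume \<epsilon>: "\<epsilon> \<in> E a b"
        have "\<epsilon> = (SOME \<epsilon>. \<epsilon> \<in> E a b)"
          by (rule single[OF \<epsilon> someI[of "\<lambda>\<epsilon>. \<epsilon> \<in> E a b", OF \<epsilon>]]) (use that p in simp)
        then show "\<epsilon> \<in> {SOME \<epsilon>. \<epsilon> \<in> E a b}" by simp
      qed
      then show ?thesis unfolding p by (simp add: countable_subset[of _ "{_}"])
    qed
  qed
  then have "(\<Union>(a, b)\<in>I. E a b) \<noteq> UNIV" using uncountable_UNIV_real by metis
  then obtain \<epsilon> where \<epsilon>: "\<epsilon> \<notin> (\<Union>(a, b)\<in>I. E a b)" by blast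
  show ?thesis
  proof
    fix a b :: real
    assume ab: "a < b" "{a..b} \<inter> C = {}"
    \<comment> \<open>Constancy on \<open>{a..b}\<close> would pass to a rational subinterval, which
      \<epsilon> already avoids.\<close>
    obtain a' where a': "a' \<in> \<rat>" "a < a'" "a' < b" using Rats_dense_in_real[OF ab(1)] by blast
    obtain b' where b': "b' \<in> \<rat>" "a' < b'" "b' < b" using Rats_dense_in_real[OF a'(3)] by blast
    have sub: "{a'..b'} \<subseteq> {a..b}" using a' b' by auto
    then have "{a'..b'} \<inter> C = {}" using ab(2) by blast
    then have "(a', b') \<in> I" unfolding I_def using a' b' by simp
    then have "\<epsilon> \<notin> E a' b'" using \<epsilon> by blast
    then show "\<not> (\<lambda>s. f s + \<epsilon> * h s) constant_on {a..b}"
      unfolding E_def using sub constant_on_subset by blast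
  qed
qed

text \<open>The point of C nearest to the midpoint lies beyond an endpoint, and that endpoint is
  strictly closer to it than the midpoint is.\<close>

lemma infdist_not_constant_on_interval:
  fixes C :: "real set"
  assumes "closed C" "C \<noteq> {}" "a < b" "{a..b} \<inter> C = {}"
  shows "\<not> (\<lambda>s. infdist s C) constant_on {a..b}"
proof
  assume "(\<lambda>s. infdist s C) constant_on {a..b}"
  then obtain r where r: "\<And>s. s \<in> {a..b} \<Longrightarrow> infdist s C = r" unfolding constant_on_def by auto
  define m where "m = (a + b) / 2"
  have m: "a < m" "m < b" using assms unfolding m_def by auto
  obtain c where c: "c \<in> C" "infdist m C = dist m c"
    using infdist_attains_inf[OF assms(1,2)] by blast
  have "c \<notin> {a..b}" using c assms by auto
  then consider "c < a" | "c > b" by fastforce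
  then show False
  proof cases
    case 1
    then show ?thesis using infdist_le[OF c(1), of a] r[of a] r[of m] c(2) m by (auto simp: dist_real_def)
  next
    case 2
    then show ?thesis using infdist_le[OF c(1), of b] r[of b] r[of m] c(2) m by (auto simp: dist_real_def)
  qed
qed

text \<open>Two coordinates share the work: coordinate c recovers u once \<open>h s\<close> is
  nonzero, while coordinate d depends on s alone and restricts which parameters a fibre can
  use.\<close>

lemma compact_fibre_model:
  fixes A :: "(real ^ 'm::finite) set"
  assumes A: "compact A" and m: "CARD('m) > 1"
  obtains G :: "real \<Rightarrow> real \<Rightarrow> real ^ 'm" where
    "continuous_on UNIV (\<lambda>(s, u). G s u)"
    "\<And>p. p \<in> A \<Longrightarrow> \<exists>s\<in>{0..1}. \<forall>u. G s u = p"
    "\<And>p s u v. p \<notin> A \<Longrightarrow> s \<in> {0..1} \<Longrightarrow> G s u = p \<Longrightarrow> G s v = p \<Longrightarrow> u = v"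
    "\<And>p a b. p \<notin> A \<Longrightarrow> 0 \<le> a \<Longrightarrow> a < b \<Longrightarrow> b \<le> 1 \<Longrightarrow> \<exists>s\<in>{a..b}. \<forall>u. G s u \<noteq> p"
proof -
  obtain c d :: 'm where cd: "c \<noteq> d"
    using m by (metis UNIV_I card_le_Suc0_iff_eq finite_class.finite_UNIV linorder_not_le One_nat_def)
  obtain \<gamma> :: "real \<Rightarrow> real ^ 'm" where \<gamma>: "continuous_on UNIV \<gamma>" "A \<subseteq> \<gamma> ` {0..1}"
    using space_filling_curve compact_imp_bounded[OF A] by blast
  \<comment> \<open>The point 2 lies outside the parameter interval; it keeps \<open>C\<close> nonempty when \<open>A = {}\<close>,
    so that \<open>infdist\<close> does not degenerate to 0.\<close>
  define C where "C = insert 2 ({0..1} \<inter> \<gamma> -` A)"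
  have "closed ({0..1} \<inter> \<gamma> -` A)"
    using \<gamma>(1) compact_imp_closed[OF A]
    by (intro continuous_closed_preimage) (auto intro: continuous_on_subset)
  then have C: "closed C" "C \<noteq> {}" unfolding C_def by auto
  define h where "h s = infdist s C" for s
  have h0: "h s = 0 \<longleftrightarrow> s \<in> C" for s
    unfolding h_def using C in_closed_iff_infdist_zero by blast
  obtain \<epsilon> where \<epsilon>: "\<And>a b. a < b \<Longrightarrow> {a..b} \<inter> C = {} \<Longrightarrow>
      \<not> (\<lambda>s. \<gamma> s $ d + \<epsilon> * h s) constant_on {a..b}"
    using generic_perturbation_nonconstant[of C h "\<lambda>s. \<gamma> s $ d"]
      infdist_not_constant_on_interval[OF C] unfolding h_def by blast
  define G where "G s u = \<gamma> s + (h s * u) *\<^sub>R axis c 1 + (h s * \<epsilon>) *\<^sub>R axis d 1" for s u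
  have Gc: "G s u $ c = \<gamma> s $ c + h s * u" for s u
    unfolding G_def using cd by (simp add: axis_def)
  have Gd: "G s u $ d = \<gamma> s $ d + \<epsilon> * h s" for s u
    unfolding G_def using cd by (simp add: axis_def)
  \<comment> \<open>On C the distance \<open>h s\<close> vanishes and \<open>G s u\<close> is
    \<open>\<gamma> s\<close>; the extra point 2 is excluded by the range of s.\<close>
  have hit: "p \<in> A" if "s \<in> {0..1}" "s \<in> C" "G s u = p" for s u p
    using that h0[of s] unfolding C_def G_def by auto
  show ?thesis
  proof
    show "continuous_on UNIV (\<lambda>(s, u). G s u)"
      unfolding G_def h_def split_def
      by (intro continuous_intros continuous_on_compose2[OF \<gamma>(1)]) auto
    show "\<exists>s\<in>{0..1}. \<forall>u. G s u = p" if p: "p \<in> A" for p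
    proof -
      obtain s where "s \<in> {0..1}" "\<gamma> s = p" using \<gamma>(2) p by blast
      then show ?thesis
        using p h0[of s] unfolding C_def G_def by (intro bexI[of _ s]) auto
    qed
    show "u = v" if "p \<notin> A" "s \<in> {0..1}" "G s u = p" "G s v = p" for p s u v
    proof -
      have "h s \<noteq> 0" using hit that h0 by blast
      moreover have "h s * u = h s * v" using Gc[of s u] Gc[of s v] that by simp
      ultimately show ?thesis by simp
    qed
    show "\<exists>s\<in>{a..b}. \<forall>u. G s u \<noteq> p" if "p \<notin> A" "0 \<le> a" "a < b" "b \<le> 1" for p a b
    proof (rule ccontr)
      \<comment> \<open>If the fibre met every line over \<open>{a..b}\<close>, that interval would
        miss C and coordinate d would equal \<open>p $ d\<close> throughout, against the choice of
        \<epsilon>.\<close>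
      assume "\<not> ?thesis"
      then have *: "\<exists>u. G s u = p" if "s \<in> {a..b}" for s using that by blast
      have "s \<notin> C" if "s \<in> {a..b}" for s
        using *[OF that] hit[of s] that \<open>p \<notin> A\<close> \<open>0 \<le> a\<close> \<open>b \<le> 1\<close> by fastforce
      then have "{a..b} \<inter> C = {}" by blast
      moreover have "(\<lambda>s. \<gamma> s $ d + \<epsilon> * h s) constant_on {a..b}"
        unfolding constant_on_def using * Gd by metis
      ultimately show False using \<epsilon> \<open>a < b\<close> by blast
    qed
  qed
qed

section \<open>Connections in the complement of a closed subset of the square\<close>

text \<open>
  Call a parameter good if the vertical line over it avoids \<open>F\<close>.  Around any parameter some
  short horizontal segment avoids \<open>F\<close>, and it links all nearby good vertical lines.
\<close>

lemma connected_component_square_minus_closed: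
  fixes F :: "(real \<times> real) set"
  assumes F: "closed F"
    and avail: "\<And>s. s \<in> {0..1} \<Longrightarrow> \<exists>u\<in>{0..1}. (s, u) \<notin> F"
    and dense: "\<And>a b. 0 \<le> a \<Longrightarrow> a < b \<Longrightarrow> b \<le> 1 \<Longrightarrow> \<exists>s\<in>{a..b}. \<forall>u\<in>{0..1}. (s, u) \<notin> F"
  obtains u v where "connected_component ({0..1} \<times> {0..1} - F) (0, u) (1, v)"
proof -
  let ?U = "{0..1} \<times> {0..1} - F"
  define P where "P s \<longleftrightarrow> s \<in> {0..1} \<and> (\<forall>u\<in>{0..1}. (s, u) \<notin> F)" for s
  \<comment> \<open>Follow the horizontal segment at height u, inside a ball missing F, to the good
    line over s, then that line down to height 0, the common reference height.\<close>
  have horiz: "\<exists>u \<delta>. 0 < \<delta> \<and>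
      (\<forall>s. P s \<and> \<bar>s - a\<bar> < \<delta> \<longrightarrow> connected_component ?U (a, u) (s, 0))" if a: "a \<in> {0..1}" for a
  proof -
    obtain u where u: "u \<in> {0..1}" "(a, u) \<notin> F" using avail[OF a] by blast
    then obtain \<delta> where \<delta>: "\<delta> > 0" "ball (a, u) \<delta> \<subseteq> - F"
      using F open_contains_ball by (metis ComplI open_Compl)
    have "connected_component ?U (a, u) (s, 0)" if s: "P s" "\<bar>s - a\<bar> < \<delta>" for s
    proof -
      have "closed_segment a s \<times> {u} \<subseteq> ?U"
      proof (clarify, intro conjI DiffI SigmaI)
        fix t assume t: "t \<in> closed_segment a s"
        have "closed_segment a s \<subseteq> {0..1}"
          using a s(1) closed_segment_subset[OF _ _ convex_real_interval(5)] unfolding P_def by blast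
        then show "t \<in> {0..1}" using t by blast
        show "u \<in> {0..1}" by (rule u)
        have "\<bar>t - a\<bar> \<le> \<bar>s - a\<bar>" using t by (auto simp: closed_segment_eq_real_ivl split: if_splits)
        then have "(t, u) \<in> ball (a, u) \<delta>"
          using s(2) by (simp add: dist_prod_def dist_real_def abs_minus_commute)
        then show "(t, u) \<notin> F" using \<delta>(2) by blast
      qed
      moreover have "connected (closed_segment a s \<times> {u})"
        by (intro connected_Times) auto
      ultimately have "connected_component ?U (a, u) (s, u)"
        unfolding connected_component_def by (metis SigmaI ends_in_segment insertI1)
      moreover have "connected_component ?U (s, u) (s, 0)"
      proof -
        have "{s} \<times> {0..1} \<subseteq> ?U" using s(1) unfolding P_def by auto
        moreover have "connected ({s} \<times> {0..1 :: real})" by (intro connected_Times) auto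
        ultimately show ?thesis
          unfolding connected_component_def
          using u(1) by (intro exI[of _ "{s} \<times> {0..1 :: real}"]) auto
      qed
      ultimately show ?thesis using connected_component_trans by metis
    qed
    then show ?thesis using \<delta>(1) by blast
  qed
  have near: "\<exists>s. P s \<and> \<bar>s - a\<bar> < e" if "a \<in> {0..1}" "0 < e" for a e
  proof -
    have "max 0 (a - e/2) < min 1 (a + e/2)" using that by auto
    then obtain s where "s \<in> {max 0 (a - e/2)..min 1 (a + e/2)}" "\<forall>u\<in>{0..1}. (s, u) \<notin> F"
      using dense[of "max 0 (a - e/2)" "min 1 (a + e/2)"] by auto
    then show ?thesis unfolding P_def using that by (intro exI[of _ s]) auto
  qed
  \<comment> \<open>The parameters 0 and 1 need not be good themselves; short horizontal segments
    link them to good lines nearby.\<close>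
  obtain u \<delta> where u: "0 < \<delta>"
    "\<forall>s. P s \<and> \<bar>s - 0\<bar> < \<delta> \<longrightarrow> connected_component ?U (0, u) (s, 0)"
    using horiz[of 0] by auto
  obtain v \<eta> where v: "0 < \<eta>"
    "\<forall>s. P s \<and> \<bar>s - 1\<bar> < \<eta> \<longrightarrow> connected_component ?U (1, v) (s, 0)"
    using horiz[of 1] by auto
  obtain s t where s: "P s" "\<bar>s - 0\<bar> < \<delta>" and t: "P t" "\<bar>t - 1\<bar> < \<eta>"
    using near[of 0 \<delta>] near[of 1 \<eta>] u(1) v(1) by auto
  have "connected_component ?U (s, 0) (t, 0)"
  \<comment> \<open>Good parameters are dense, and all those close to a given parameter are linked
    to one another; connectedness of the unit interval then leaves a single class.\<close>
  proof (rule connected_equivalence_relation_gen[where S = "{0..1::real}" and P = P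
        and R = "\<lambda>s t. connected_component ?U (s, 0) (t, 0)"])
    show "s \<in> {0..1}" "t \<in> {0..1}" using s t unfolding P_def by auto
    show "\<exists>z. z \<in> T \<and> P z" if T: "openin (top_of_set {0..1}) T" "a \<in> T" for T a
    proof -
      have a: "a \<in> {0..1}" using T openin_imp_subset by blast
      obtain e where e: "e > 0" "ball a e \<inter> {0..1} \<subseteq> T"
        using T openin_contains_ball by metis
      obtain z where "P z" "\<bar>z - a\<bar> < e" using near[OF a e(1)] by blast
      then show ?thesis
        using e(2) unfolding P_def by (auto simp: dist_real_def abs_minus_commute)
    qed
    show "\<exists>T. openin (top_of_set {0..1}) T \<and> a \<in> T \<and>
        (\<forall>x\<in>T. \<forall>y\<in>T. P x \<and> P y \<longrightarrow> connected_component ?U (x, 0) (y, 0))"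
      if a: "a \<in> {0..1}" for a
    proof -
      obtain w e where w: "0 < e"
        "\<forall>s. P s \<and> \<bar>s - a\<bar> < e \<longrightarrow> connected_component ?U (a, w) (s, 0)"
        using horiz[OF a] by auto
      show ?thesis
      proof (intro exI[of _ "{0..1} \<inter> ball a e"] conjI ballI impI)
        fix x y assume "x \<in> {0..1} \<inter> ball a e" "y \<in> {0..1} \<inter> ball a e" "P x \<and> P y"
        then have "connected_component ?U (a, w) (x, 0)" "connected_component ?U (a, w) (y, 0)"
          using w(2) by (auto simp: dist_real_def abs_minus_commute)
        then show "connected_component ?U (x, 0) (y, 0)"
          by (rule connected_component_trans[OF connected_component_sym])
      qed (use a w(1) in auto)
    qed
  qed (use s t in \<open>auto intro: connected_component_trans\<close>)
  moreover have "connected_component ?U (0, u) (s, 0)" "connected_component ?U (1, v) (t, 0)"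
    using u(2) v(2) s t by blast+
  ultimately have "connected_component ?U (0, u) (1, v)"
    by (meson connected_component_sym connected_component_trans)
  then show ?thesis using that by blast
qed

section \<open>Transfer from the square to the cube\<close>

text \<open>For distinct i and j the unit square becomes a two-dimensional face of the cube, where
  the required connecting sets are built.\<close>

definition embed_square :: "'n \<Rightarrow> 'n \<Rightarrow> real \<times> real \<Rightarrow> real ^ 'n" where
  "embed_square i j z = (\<chi> k. if k = i then fst z else if k = j then snd z else 0)"

lemma continuous_on_embed_square: "continuous_on S (embed_square i j)"
  unfolding embed_square_def[abs_def]
proof (rule continuous_on_vec_lambda)
  show "continuous_on S (\<lambda>z. if k = i then fst z else if k = j then snd z else 0)" for k
    by (cases "k = i"; cases "k = j") (auto intro!: continuous_intros)
qed

lemma continuous_on_two_components: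
  fixes G :: "real \<Rightarrow> real \<Rightarrow> 'b::topological_space" and i j :: "'n::finite"
  assumes "continuous_on UNIV (\<lambda>(s, u). G s u)"
  shows "continuous_on S (\<lambda>z :: real ^ 'n. G (z $ i) (z $ j))"
proof -
  have "continuous_on S (\<lambda>z :: real ^ 'n. (\<lambda>(s, u). G s u) (z $ i, z $ j))"
    by (rule continuous_on_compose2[OF assms]) (auto intro!: continuous_intros)
  then show ?thesis by simp
qed

text \<open>With s as coordinate j, a constant line of \<open>G\<close> runs from face to face. A
  connecting set over a point outside A would lie over one parameter and yet contain both u = 0 and
  u = 1.\<close>

lemma exists_Conn_eq_compact:
  fixes A :: "(real ^ 'm::finite) set" and i j :: "'n::finite"
  assumes A: "compact A" and m: "CARD('m) > 1" and ij: "i \<noteq> j"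
  shows "\<exists>g :: real ^ 'n \<Rightarrow> real ^ 'm. continuous_on unit_cube g \<and> Conn i g = A"
proof -
  obtain G :: "real \<Rightarrow> real \<Rightarrow> real ^ 'm" where G:
    "continuous_on UNIV (\<lambda>(s, u). G s u)"
    "\<And>p. p \<in> A \<Longrightarrow> \<exists>s\<in>{0..1}. \<forall>u. G s u = p"
    "\<And>p s u v. p \<notin> A \<Longrightarrow> s \<in> {0..1} \<Longrightarrow> G s u = p \<Longrightarrow> G s v = p \<Longrightarrow> u = v"
    "\<And>p a b. p \<notin> A \<Longrightarrow> 0 \<le> a \<Longrightarrow> a < b \<Longrightarrow> b \<le> 1 \<Longrightarrow> \<exists>s\<in>{a..b}. \<forall>u. G s u \<noteq> p"
    by (fact compact_fibre_model[OF A m])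
  define g :: "real ^ 'n \<Rightarrow> real ^ 'm" where "g z = G (z $ j) (z $ i)" for z
  have "p \<in> Conn i g" if p: "p \<in> A" for p
  proof -
    obtain s where s: "s \<in> {0..1}" "\<And>u. G s u = p" using G(2)[OF p] by blast
    let ?S = "embed_square i j ` ({0..1} \<times> {s})"
    have "?S \<subseteq> cube_fibre g p"
      using s ij unfolding cube_fibre_def unit_cube_def g_def embed_square_def by auto
    moreover have "connected ?S"
      by (intro connected_continuous_image continuous_on_embed_square connected_Times) auto
    moreover have "embed_square i j (0, s) \<in> ?S \<inter> face_minus i"
      using s ij unfolding face_minus_def unit_cube_def embed_square_def by auto
    moreover have "embed_square i j (1, s) \<in> ?S \<inter> face_plus i"
      using s ij unfolding face_plus_def unit_cube_def embed_square_def by auto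
    ultimately show ?thesis unfolding Conn_def connects_faces_def by blast
  qed
  moreover have "p \<in> A" if conn: "p \<in> Conn i g" for p
  proof (rule ccontr)
    assume p: "p \<notin> A"
    obtain S x y where S: "S \<subseteq> cube_fibre g p" "connected S"
      "x \<in> S" "x $ i = 0" "y \<in> S" "y $ i = 1"
      using conn unfolding Conn_def connects_faces_def face_minus_def face_plus_def by blast
    have fib: "G (z $ j) (z $ i) = p" "z $ j \<in> {0..1}" if "z \<in> S" for z
      using S(1) that unfolding cube_fibre_def unit_cube_def g_def by auto
    have proj: "connected ((\<lambda>z. z $ j) ` S)"
      by (intro connected_continuous_image S(2) continuous_intros)
    \<comment> \<open>Two distinct values would put a whole interval of parameters into the
      connected projection, including one whose line misses the fibre.\<close>
    have same: "z $ j = w $ j" if zw: "z \<in> S" "w \<in> S" for z w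
    proof (rule ccontr)
      assume "z $ j \<noteq> w $ j"
      then obtain a b where ab: "a < b" "a \<in> (\<lambda>z. z $ j) ` S" "b \<in> (\<lambda>z. z $ j) ` S"
        using zw by (metis image_eqI linorder_neq_iff)
      then have "0 \<le> a" "b \<le> 1" using fib(2) by auto
      then obtain s where s: "s \<in> {a..b}" "\<And>u. G s u \<noteq> p" using G(4)[OF p _ ab(1)] by blast
      have "s \<in> (\<lambda>z. z $ j) ` S"
        using connected_contains_Icc[OF proj ab(2,3)] s(1) by blast
      then show False using fib(1) s(2) by blast
    qed
    have "G (x $ j) (y $ i) = p" using fib(1)[OF S(5)] same[OF S(3,5)] by simp
    then have "x $ i = y $ i" by (rule G(3)[OF p fib(2)[OF S(3)] fib(1)[OF S(3)]])
    then show False using S by simp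
  qed
  moreover have "continuous_on unit_cube g"
    unfolding g_def by (rule continuous_on_two_components[OF G(1)])
  ultimately show ?thesis by blast
qed

text \<open>With s as coordinate i, a constant line of \<open>G\<close> becomes a full slice of the
  cube, which every connecting set must cross.\<close>

lemma exists_Sep_eq_compact:
  fixes A :: "(real ^ 'm::finite) set" and i j :: "'n::finite"
  assumes A: "compact A" and m: "CARD('m) > 1" and ij: "i \<noteq> j"
  shows "\<exists>g :: real ^ 'n \<Rightarrow> real ^ 'm. continuous_on unit_cube g \<and> Sep i g = A"
proof -
  obtain G :: "real \<Rightarrow> real \<Rightarrow> real ^ 'm" where G:
    "continuous_on UNIV (\<lambda>(s, u). G s u)"
    "\<And>p. p \<in> A \<Longrightarrow> \<exists>s\<in>{0..1}. \<forall>u. G s u = p"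
    "\<And>p s u v. p \<notin> A \<Longrightarrow> s \<in> {0..1} \<Longrightarrow> G s u = p \<Longrightarrow> G s v = p \<Longrightarrow> u = v"
    "\<And>p a b. p \<notin> A \<Longrightarrow> 0 \<le> a \<Longrightarrow> a < b \<Longrightarrow> b \<le> 1 \<Longrightarrow> \<exists>s\<in>{a..b}. \<forall>u. G s u \<noteq> p"
    by (fact compact_fibre_model[OF A m])
  define g :: "real ^ 'n \<Rightarrow> real ^ 'm" where "g z = G (z $ i) (z $ j)" for z
  have "p \<in> Sep i g" if p: "p \<in> A" for p
  proof -
    obtain s where s: "s \<in> {0..1}" "\<And>u. G s u = p" using G(2)[OF p] by blast
    have False if S: "S \<subseteq> unit_cube - cube_fibre g p" "connected S"
      "S \<inter> face_minus i \<noteq> {}" "S \<inter> face_plus i \<noteq> {}" for S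
    proof -
      have "connected ((\<lambda>z. z $ i) ` S)"
        by (intro connected_continuous_image S(2) continuous_intros)
      moreover have "0 \<in> (\<lambda>z. z $ i) ` S" "1 \<in> (\<lambda>z. z $ i) ` S"
        using S(3,4) unfolding face_minus_def face_plus_def by force+
      ultimately have "s \<in> (\<lambda>z. z $ i) ` S"
        using connected_contains_Icc s(1) by blast
      then show False using S(1) s(2) unfolding cube_fibre_def g_def by blast
    qed
    then show ?thesis unfolding Sep_def separates_faces_def connects_faces_def by blast
  qed
  moreover have "p \<in> A" if sep: "p \<in> Sep i g" for p
  proof (rule ccontr)
    assume p: "p \<notin> A"
    define F where "F = (\<lambda>(s, u). G s u) -` {p}"
    have F: "closed F"
      unfolding F_def by (rule closed_vimage[OF closed_singleton G(1)])
    obtain u v where "connected_component ({0..1} \<times> {0..1} - F) (0, u) (1, v)"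
    proof (rule connected_component_square_minus_closed[OF F])
      show "\<exists>u\<in>{0..1}. (s, u) \<notin> F" if "s \<in> {0..1}" for s
      proof -
        \<comment> \<open>The fibre has at most one point on each vertical line, so it cannot
          contain both ends.\<close>
        have "(s, 0) \<notin> F \<or> (s, 1) \<notin> F" using G(3)[OF p that, of 0 1] unfolding F_def by auto
        then show ?thesis by force
      qed
      show "\<exists>s\<in>{a..b}. \<forall>u\<in>{0..1}. (s, u) \<notin> F" if "0 \<le> a" "a < b" "b \<le> 1" for a b
        using G(4)[OF p that] unfolding F_def by auto
    qed
    then obtain T where T: "connected T" "T \<subseteq> {0..1} \<times> {0..1} - F" "(0, u) \<in> T" "(1, v) \<in> T"
      unfolding connected_component_def by blast
    let ?S = "embed_square i j ` T"
    have cube: "embed_square i j z \<in> unit_cube" if "z \<in> T" for z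
      using T(2) that unfolding unit_cube_def embed_square_def by auto
    have "g (embed_square i j z) \<noteq> p" if "z \<in> T" for z
      using T(2) that ij unfolding F_def g_def embed_square_def by auto
    then have "?S \<subseteq> unit_cube - cube_fibre g p"
      using cube unfolding cube_fibre_def by blast
    moreover have "connected ?S"
      by (intro connected_continuous_image continuous_on_embed_square T(1))
    moreover have "embed_square i j (0, u) \<in> ?S \<inter> face_minus i"
      using T(3) cube[OF T(3)] unfolding face_minus_def by (simp add: embed_square_def)
    moreover have "embed_square i j (1, v) \<in> ?S \<inter> face_plus i"
      using T(4) cube[OF T(4)] unfolding face_plus_def by (simp add: embed_square_def)
    ultimately have "connects_faces i (unit_cube - cube_fibre g p)"
      unfolding connects_faces_def by blast
    then show False using sep unfolding Sep_def separates_faces_def by blast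
  qed
  moreover have "continuous_on unit_cube g"
    unfolding g_def by (rule continuous_on_two_components[OF G(1)])
  ultimately show ?thesis by blast
qed

theorem theorem5p16:
  fixes i :: "'n::finite"
    and A :: "(real ^ 'm::finite) set"
  assumes "CARD('m) > 1" and "CARD('n) > 1"
  shows "(compact A \<longleftrightarrow>
           (\<exists>g :: real ^ 'n \<Rightarrow> real ^ 'm. continuous_on unit_cube g \<and> Conn i g = A))
       \<and> (compact A \<longleftrightarrow>
           (\<exists>g :: real ^ 'n \<Rightarrow> real ^ 'm. continuous_on unit_cube g \<and> Sep i g = A))"
proof -
  obtain j where "i \<noteq> j"
    using assms(2) by (metis UNIV_I card_le_Suc0_iff_eq finite_class.finite_UNIV linorder_not_le One_nat_def)
  show ?thesis
  proof (intro conjI iffI)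
    show "\<exists>g :: real ^ 'n \<Rightarrow> real ^ 'm. continuous_on unit_cube g \<and> Conn i g = A" if "compact A"
      by (rule exists_Conn_eq_compact[OF that assms(1) \<open>i \<noteq> j\<close>])
    show "\<exists>g :: real ^ 'n \<Rightarrow> real ^ 'm. continuous_on unit_cube g \<and> Sep i g = A" if "compact A"
      by (rule exists_Sep_eq_compact[OF that assms(1) \<open>i \<noteq> j\<close>])
  qed (auto intro: compact_Conn compact_Sep)
qed

end
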